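(* Let $\mathscr{H}$ and $\mathscr{K}$ be Hilbert spaces, let $R$ be a linear operator from $\mathscr{H}$ to $\mathscr{K}$, and let $B,S$ be linear operators from $\mathscr{K}$ to $\mathscr{H}$, satisfying the following conditions: (a) $\operatorname{dom} B^*\subseteq\operatorname{dom} R$ and $\operatorname{dom} B\subseteq\operatorname{dom} S$; (b) $B$ is densely defined and closable; (c) $B^*+R$ is closed; (d) $(Rh\,|\,k)=(h\,|\,Sk)$ for all $h\in\operatorname{dom} B^*$ and $k\in\operatorname{dom} B$; (e) $\|Rh\|^2\leq\|B^*h\|^2+\|h\|^2$ for all $h\in\operatorname{dom} B^*$; (f) $\|Sk\|^2\leq\|Bk\|^2+\|k\|^2$ for all $k\in\operatorname{dom} B$. Then $B+S$ is (densely defined and) closable, and $(B+S)^*=B^*+R$.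
   Context: Hilbert spaces are real or complex (all over the same scalar field). A linear operator between Hilbert spaces is a possibly unbounded, not necessarily densely defined linear map defined on a linear subspace $\operatorname{dom}$ of its source space. All scalar products are denoted $(\cdot\,|\,\cdot)$. A sum of operators is defined on the intersection of their domains, so $\operatorname{dom}(B^*+R)=\operatorname{dom}B^*$ and $\operatorname{dom}(B+S)=\operatorname{dom}B$ here. $A^*$ is the adjoint of a densely defined operator $A$. An operator is closed if its graph is closed, and closable if the closure of its graph is the graph of an operator. *)

theory Defs
  imports "HOL-Analysis.Analysis"
begin

(* The scalar field. An R-linear multiplicative isometric embedding into the complex numbers
   leaves exactly two possibilities, see range_to_complex and the instances below; it is used
   to speak about complex conjugation uniformly. *)
class real_or_complex = real_normed_field +
  fixes to_complex :: "'a \<Rightarrow> complex"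
  assumes to_complex_add: "to_complex (a + b) = to_complex a + to_complex b"
    and to_complex_mult: "to_complex (a * b) = to_complex a * to_complex b"
    and to_complex_scaleR: "to_complex (r *\<^sub>R a) = r *\<^sub>R to_complex a"
    and norm_to_complex: "norm (to_complex a) = norm a"

lemma to_complex_of_real: "to_complex (of_real r :: 'a::real_or_complex) = of_real r"
proof -
  have "to_complex (1::'a) * to_complex (1::'a) = to_complex (1::'a)"
    using to_complex_mult[of "1::'a" 1] by simp
  moreover have "to_complex (1::'a) \<noteq> 0"
    using norm_to_complex[of "1::'a"] by auto
  ultimately have "to_complex (1::'a) = 1"
    by simp
  then show ?thesis
    using to_complex_scaleR[of r "1::'a"] by (simp add: of_real_def)
qed

lemma range_to_complex:
  "range (to_complex :: 'a::real_or_complex \<Rightarrow> complex) = \<real> \<or>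
   range (to_complex :: 'a \<Rightarrow> complex) = UNIV"
proof (cases "range (to_complex :: 'a \<Rightarrow> complex) \<subseteq> \<real>")
  case True
  have "\<real> \<subseteq> range (to_complex :: 'a \<Rightarrow> complex)"
    by (metis Reals_cases rangeI subsetI to_complex_of_real)
  with True show ?thesis by blast
next
  case False
  then obtain a :: 'a where a: "to_complex a \<notin> \<real>" by blast
  then have im: "Im (to_complex a) \<noteq> 0" by (simp add: complex_is_Real_iff)
  have "z \<in> range (to_complex :: 'a \<Rightarrow> complex)" for z
  proof -
    define s where "s = Im z / Im (to_complex a)"
    have "to_complex (of_real (Re z - s * Re (to_complex a)) + s *\<^sub>R a) = z"
      using im unfolding to_complex_add to_complex_of_real to_complex_scaleR
      by (simp add: complex_eq_iff s_def)
    then show ?thesis by (metis rangeI)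
  qed
  then show ?thesis by blast
qed

instantiation real :: real_or_complex
begin
definition to_complex_real :: "real \<Rightarrow> complex" where "to_complex_real = of_real"
instance by standard (auto simp: to_complex_real_def scaleR_conv_of_real)
end

instantiation complex :: real_or_complex
begin
definition to_complex_complex :: "complex \<Rightarrow> complex" where "to_complex_complex = id"
instance by standard (auto simp: to_complex_complex_def)
end

(* A Hilbert space with scalar field 's. Topology, completeness and the restriction of the
   scalar multiplication to real scalars come from the class banach; the last assumption says
   that the norm is the one of the inner product, which in particular is positive definite.
   The inner product is linear in its first argument. *)
locale hilbert_space = vector_space scale
  for scale :: "'s::real_or_complex \<Rightarrow> 'a::banach \<Rightarrow> 'a" +
  fixes ip :: "'a \<Rightarrow> 'a \<Rightarrow> 's"
  assumes scale_of_real: "scale (of_real r) x = r *\<^sub>R x"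
    and ip_add_left: "ip (x + y) z = ip x z + ip y z"
    and ip_scale_left: "ip (scale c x) y = c * ip x y"
    and ip_commute: "to_complex (ip y x) = cnj (to_complex (ip x y))"
    and ip_self: "ip x x = of_real ((norm x)\<^sup>2)"

lemma hilbert_space_real_inner:
  "hilbert_space scaleR (inner :: 'a::{real_inner, banach} \<Rightarrow> 'a \<Rightarrow> real)"
  by standard
    (auto simp: inner_add_left inner_add_right inner_commute to_complex_real_def power2_norm_eq_inner
      scaleR_add_right scaleR_add_left)

lemma hilbert_space_complex:
  "hilbert_space (*) (\<lambda>x y :: complex. x * cnj y)"
  by standard
    (auto simp: algebra_simps to_complex_complex_def scaleR_conv_of_real simp flip: complex_norm_square)

(* A partially defined operator is a map 'a \<rightharpoonup> 'b, so that equality of operators means equality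
   of domains and of values. *)
definition linear_operator ::
  "('s::field \<Rightarrow> 'a::ab_group_add \<Rightarrow> 'a) \<Rightarrow> ('s \<Rightarrow> 'b::ab_group_add \<Rightarrow> 'b) \<Rightarrow> ('a \<rightharpoonup> 'b) \<Rightarrow> bool"
  where "linear_operator scaleA scaleB T \<longleftrightarrow>
    module.subspace scaleA (dom T) \<and>
    (\<forall>x\<in>dom T. \<forall>y\<in>dom T. the (T (x + y)) = the (T x) + the (T y)) \<and>
    (\<forall>c. \<forall>x\<in>dom T. the (T (scaleA c x)) = scaleB c (the (T x)))"

definition op_plus :: "('a \<rightharpoonup> 'b::plus) \<Rightarrow> ('a \<rightharpoonup> 'b) \<Rightarrow> ('a \<rightharpoonup> 'b)"
  where "op_plus S T =
    (\<lambda>x. if x \<in> dom S \<inter> dom T then Some (the (S x) + the (T x)) else None)"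

definition densely_defined :: "('a::topological_space \<rightharpoonup> 'b) \<Rightarrow> bool"
  where "densely_defined T \<longleftrightarrow> closure (dom T) = UNIV"

definition closed_operator :: "('a::topological_space \<rightharpoonup> 'b::topological_space) \<Rightarrow> bool"
  where "closed_operator T \<longleftrightarrow> closed (Map.graph T)"

definition closable_operator ::
  "('s::field \<Rightarrow> 'a::{ab_group_add, topological_space} \<Rightarrow> 'a) \<Rightarrow>
   ('s \<Rightarrow> 'b::{ab_group_add, topological_space} \<Rightarrow> 'b) \<Rightarrow> ('a \<rightharpoonup> 'b) \<Rightarrow> bool"
  where "closable_operator scaleA scaleB T \<longleftrightarrow>
    (\<exists>T'. linear_operator scaleA scaleB T' \<and> Map.graph T' = closure (Map.graph T))"

(* Meaningful for densely defined T only: then the vector z is unique. *)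
definition op_adjoint ::
  "('a \<Rightarrow> 'a \<Rightarrow> 's) \<Rightarrow> ('b \<Rightarrow> 'b \<Rightarrow> 's) \<Rightarrow> ('a \<rightharpoonup> 'b) \<Rightarrow> ('b \<rightharpoonup> 'a)"
  where "op_adjoint ipA ipB T = (\<lambda>y.
    if \<exists>z. \<forall>x\<in>dom T. ipB (the (T x)) y = ipA x z
    then Some (THE z. \<forall>x\<in>dom T. ipB (the (T x)) y = ipA x z)
    else None)"

end

theory Submission
  imports Defs
begin

text \<open>
  Write \<open>A = B\<^sup>*\<close>. Hypothesis (d) gives \<open>A + R \<subseteq> (B + S)\<^sup>*\<close> at once; the content is the converse
  inclusion. The conditions put the pair into the setting of Wuest's theorem on perturbations with
  relative bound one, in the off-diagonal form on the product of the two spaces: with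
  \<open>M(x, k) = (B k + x, A x - k)\<close> and \<open>P(x, k) = (S k, R x)\<close> on \<open>dom A \<times> dom B\<close>, the operator
  \<open>P\<close> is symmetric by (d), and (e) and (f) say exactly that \<open>\<parallel>P z\<parallel> \<le> \<parallel>M z\<parallel>\<close>, because the cross terms
  in \<open>\<parallel>M z\<parallel>\<^sup>2\<close> cancel. The signs \<open>+x\<close>, \<open>-k\<close> do the work that \<open>\<plusminus>i\<close> does for
  self-adjoint operators, which makes the argument independent of the scalar field.

  The same cancellation gives \<open>\<parallel>M z + t P z\<parallel> \<ge> \<parallel>z\<parallel>\<close> for every real \<open>t\<close>. The range of \<open>M\<close> is
  dense, since \<open>(u, v)\<close> orthogonal to it satisfies \<open>v = A u\<close> and \<open>\<parallel>u\<parallel>\<^sup>2 + \<parallel>A u\<parallel>\<^sup>2 = 0\<close>. For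
  \<open>0 \<le> t < 1\<close> the range of \<open>M + t P\<close> remains dense (\<open>dense_range_small_perturbation\<close>).
  At \<open>t = 1\<close>, approximate solutions of \<open>M z + t P z = y\<close> are bounded and leave the defect
  \<open>(1 - t) P z\<close>, which is bounded and tends weakly to zero as \<open>t \<rightarrow> 1\<close>; so a vector \<open>y\<close>
  orthogonal to the range of \<open>M + P\<close> vanishes (\<open>orthogonal_range_trivial_at_bound_one\<close>).

  Now take \<open>(h, w)\<close> in the graph of \<open>(B + S)\<^sup>*\<close> and subtract its orthogonal projection onto the
  closed graph of \<open>A + R\<close>. The difference is orthogonal to the range of \<open>M + P\<close>, hence is zero,
  and \<open>(h, w)\<close> lies in the graph of \<open>A + R\<close> (\<open>perturbed_adjoint_maximal\<close>).

  Closability of \<open>B\<close> enters through the density of \<open>dom B\<^sup>*\<close> (\<open>op_adjoint_dense\<close>), which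
  gives the weak convergence; the same density, read backwards for \<open>B + S\<close>, gives closability of the sum
  (\<open>closable_if_op_adjoint_dense\<close>). Only real parts of scalar products occur in all this, so both
  scalar fields are treated as real Hilbert spaces.
\<close>

section \<open>Closures of subspaces\<close>

lemma closure_add_closed:
  fixes S :: "'a::real_normed_vector set"
  assumes "\<And>x y. x \<in> S \<Longrightarrow> y \<in> S \<Longrightarrow> x + y \<in> S" "x \<in> closure S" "y \<in> closure S"
  shows "x + y \<in> closure S"
proof -
  obtain f g where "\<And>n. f n \<in> S" "f \<longlonglongrightarrow> x" "\<And>n. g n \<in> S" "g \<longlonglongrightarrow> y"
    using assms(2,3) unfolding closure_sequential by blast
  then have "(\<lambda>n. f n + g n) \<longlonglongrightarrow> x + y" "\<And>n. f n + g n \<in> S"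
    using assms(1) by (auto intro: tendsto_add)
  then show ?thesis
    unfolding closure_sequential by (intro exI[of _ "\<lambda>n. f n + g n"]) blast
qed

lemma closure_map_closed:
  assumes "continuous_on UNIV f" "\<And>x. x \<in> S \<Longrightarrow> f x \<in> S" "x \<in> closure S"
  shows "f x \<in> closure S"
proof -
  have "f ` closure S \<subseteq> closure S"
    by (rule image_closure_subset) (use assms closure_subset in \<open>auto intro: continuous_on_subset\<close>)
  then show ?thesis using assms(3) by blast
qed

lemma subspace_closure:
  fixes S :: "'a::real_normed_vector set"
  assumes "subspace S"
  shows "subspace (closure S)"
proof (rule subspaceI)
  show "0 \<in> closure S"
    using subspace_0[OF assms] closure_subset by blast
  show "x + y \<in> closure S" if "x \<in> closure S" "y \<in> closure S" for x y
    using closure_add_closed[OF subspace_add[OF assms] that] .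
  show "c *\<^sub>R x \<in> closure S" if "x \<in> closure S" for c x
    by (rule closure_map_closed[OF _ _ that])
      (auto intro: subspace_scale[OF assms] continuous_intros)
qed

lemma subspace_image_linear_on:
  assumes D: "subspace D"
    and add: "\<And>x y. x \<in> D \<Longrightarrow> y \<in> D \<Longrightarrow> f (x + y) = f x + f y"
    and scale: "\<And>r x. x \<in> D \<Longrightarrow> f (r *\<^sub>R x) = r *\<^sub>R f x"
  shows "subspace (f ` D)"
proof (rule subspaceI)
  show "0 \<in> f ` D"
    using subspace_0[OF D] scale[of 0 0] by force
  show "u + v \<in> f ` D" if "u \<in> f ` D" "v \<in> f ` D" for u v
    using that subspace_add[OF D] by (auto simp flip: add)
  show "r *\<^sub>R u \<in> f ` D" if "u \<in> f ` D" for r u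
    using that subspace_scale[OF D] by (auto simp flip: scale)
qed

section \<open>Real inner products and orthogonal projection\<close>

text \<open>The inner product is a parameter and not the one of the class \<open>real_inner\<close>, because it is to be
  instantiated by the real part of a scalar product over either scalar field.\<close>

locale real_inner_product =
  fixes ip :: "'a::real_normed_vector \<Rightarrow> 'a \<Rightarrow> real"
  assumes ip_add: "ip (x + y) z = ip x z + ip y z"
    and ip_scaleR: "ip (r *\<^sub>R x) y = r * ip x y"
    and ip_sym: "ip x y = ip y x"
    and ip_norm: "ip x x = (norm x)\<^sup>2"
begin

lemma ip_add_right: "ip x (y + z) = ip x y + ip x z"
  by (metis ip_add ip_sym)

lemma ip_scaleR_right: "ip x (r *\<^sub>R y) = r * ip x y"
  by (metis ip_scaleR ip_sym)

lemma ip_diff: "ip (x - y) z = ip x z - ip y z"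
  using ip_add[of x "(-1) *\<^sub>R y" z] unfolding ip_scaleR by simp

lemma ip_diff_right: "ip x (y - z) = ip x y - ip x z"
  by (metis ip_diff ip_sym)

lemma norm_add_sq: "(norm (x + y))\<^sup>2 = (norm x)\<^sup>2 + 2 * ip x y + (norm y)\<^sup>2"
  using ip_sym[of x y] by (simp add: ip_add ip_add_right flip: ip_norm)

lemma norm_diff_sq: "(norm (x - y))\<^sup>2 = (norm x)\<^sup>2 - 2 * ip x y + (norm y)\<^sup>2"
  using ip_sym[of x y] by (simp add: ip_diff ip_diff_right flip: ip_norm)

text \<open>Pythagoras for the component of \<open>x\<close> along \<open>y\<close>: it yields both the variational
  characterization of orthogonality and the Cauchy-Schwarz inequality.\<close>

lemma norm_diff_projection_sq:
  assumes "y \<noteq> 0"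
  shows "(norm (x - (ip x y / (norm y)\<^sup>2) *\<^sub>R y))\<^sup>2 = (norm x)\<^sup>2 - (ip x y)\<^sup>2 / (norm y)\<^sup>2"
  using assms unfolding norm_diff_sq ip_scaleR_right
  by (simp add: power_mult_distrib field_simps power2_eq_square)

lemma ip_eq_0_if_closest:
  assumes "\<And>r. norm x \<le> norm (x - r *\<^sub>R y)"
  shows "ip x y = 0"
proof (cases "y = 0")
  case True
  then show ?thesis using ip_scaleR_right[of x 0 0] by simp
next
  case False
  have "(norm x)\<^sup>2 \<le> (norm x)\<^sup>2 - (ip x y)\<^sup>2 / (norm y)\<^sup>2"
    unfolding norm_diff_projection_sq[OF False, symmetric] using assms by (simp add: power_mono)
  then show ?thesis
    using False by (simp add: divide_le_0_iff)
qed

lemma Cauchy_Schwarz: "\<bar>ip x y\<bar> \<le> norm x * norm y"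
proof (cases "y = 0")
  case True
  then show ?thesis using ip_scaleR_right[of x 0 0] by simp
next
  case False
  have "0 \<le> (norm x)\<^sup>2 - (ip x y)\<^sup>2 / (norm y)\<^sup>2"
    unfolding norm_diff_projection_sq[OF False, symmetric] by simp
  then have "(ip x y)\<^sup>2 \<le> (norm x * norm y)\<^sup>2"
    using False by (simp add: field_simps power_mult_distrib)
  then show ?thesis
    by (simp add: abs_le_square_iff[symmetric] abs_mult)
qed

sublocale bounded_bilinear ip
proof
  show "\<exists>K. \<forall>a b. norm (ip a b) \<le> norm a * norm b * K"
    using Cauchy_Schwarz by (intro exI[of _ 1]) auto
qed (simp_all add: ip_add ip_add_right ip_scaleR ip_scaleR_right)

lemma closed_orthogonal: "closed {x. ip x y = 0}"
  by (intro closed_Collect_eq continuous_intros continuous_on)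

lemma orthogonal_closure:
  assumes "\<And>x. x \<in> S \<Longrightarrow> ip x y = 0" "x \<in> closure S"
  shows "ip x y = 0"
  using closure_minimal[OF _ closed_orthogonal, of S y] assms by blast

lemma eq_0_if_orthogonal_dense:
  assumes "closure S = UNIV" "\<And>x. x \<in> S \<Longrightarrow> ip x y = 0"
  shows "y = 0"
  using orthogonal_closure[of S y y] assms by (simp add: ip_norm)

end

lemma real_inner_product_prod:
  assumes "real_inner_product ip1" "real_inner_product ip2"
  shows "real_inner_product (\<lambda>x y. ip1 (fst x) (fst y) + ip2 (snd x) (snd y))"
proof -
  interpret a: real_inner_product ip1 by fact
  interpret b: real_inner_product ip2 by fact
  show ?thesis
    by standard (simp_all add: a.ip_add b.ip_add a.ip_scaleR b.ip_scaleR a.ip_norm b.ip_norm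
        norm_prod_def distrib_left, metis a.ip_sym b.ip_sym)
qed

locale real_hilbert_space = real_inner_product ip
  for ip :: "'a::banach \<Rightarrow> 'a \<Rightarrow> real"
begin

text \<open>A minimizing sequence for the distance from \<open>x\<close> to \<open>C\<close> is Cauchy by the parallelogram
  law, and the difference between \<open>x\<close> and its limit is orthogonal to \<open>C\<close> by minimality.\<close>

lemma projection:
  assumes "closed C" "subspace C"
  obtains p where "p \<in> C" "\<And>y. y \<in> C \<Longrightarrow> ip (x - p) y = 0"
proof -
  define d where "d = infdist x C"
  have "C \<noteq> {}" using assms(2) subspace_0 by blast
  have d_le: "d\<^sup>2 \<le> (norm (x - y))\<^sup>2" if "y \<in> C" for y
    using infdist_le[OF that, of x] by (auto simp: d_def dist_norm infdist_nonneg intro!: power_mono)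
  have "\<exists>y\<in>C. (norm (x - y))\<^sup>2 < d\<^sup>2 + 1 / real (Suc n)" for n
  proof -
    have "d < sqrt (d\<^sup>2 + 1 / real (Suc n))"
      by (rule real_less_rsqrt) auto
    then obtain y where "y \<in> C" "dist x y < sqrt (d\<^sup>2 + 1 / real (Suc n))"
      using cInf_lessD[of "dist x ` C"] \<open>C \<noteq> {}\<close> by (auto simp: d_def infdist_def)
    then show ?thesis
      by (metis dist_norm norm_ge_zero real_sqrt_abs real_sqrt_less_iff abs_norm_cancel)
  qed
  then obtain p where pC: "\<And>n. p n \<in> C"
    and p: "\<And>n. (norm (x - p n))\<^sup>2 < d\<^sup>2 + 1 / real (Suc n)"
    by metis
  have pp: "(norm (p m - p n))\<^sup>2 \<le> 2 / real (Suc m) + 2 / real (Suc n)" for m n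
  proof -
    \<comment> \<open>The midpoint lies in \<open>C\<close>, so the sum of the two differences has norm at least \<open>2 d\<close>.\<close>
    have "(1/2) *\<^sub>R (p m + p n) \<in> C"
      using pC assms(2) by (simp add: subspace_add subspace_scale)
    then have "d\<^sup>2 \<le> (norm (x - (1/2) *\<^sub>R (p m + p n)))\<^sup>2"
      by (rule d_le)
    also have "x - (1/2) *\<^sub>R (p m + p n) = (1/2) *\<^sub>R ((x - p m) + (x - p n))"
      by (simp add: algebra_simps) (metis field_sum_of_halves scaleR_left_distrib scaleR_one)
    also have "(norm \<dots>)\<^sup>2 = (norm ((x - p m) + (x - p n)))\<^sup>2 / 4"
      by (simp add: power_divide)
    finally have "4 * d\<^sup>2 \<le> (norm ((x - p m) + (x - p n)))\<^sup>2" by simp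
    moreover have "(norm ((x - p m) + (x - p n)))\<^sup>2 + (norm ((x - p n) - (x - p m)))\<^sup>2
        = 2 * (norm (x - p m))\<^sup>2 + 2 * (norm (x - p n))\<^sup>2"
      unfolding norm_add_sq norm_diff_sq by (simp add: ip_sym)
    moreover have "(x - p n) - (x - p m) = p m - p n" by simp
    ultimately show ?thesis
      using p[of m] p[of n] by simp
  qed
  have "Cauchy p"
  proof (rule metric_CauchyI)
    fix e :: real assume "0 < e"
    then obtain N where N: "4 / e\<^sup>2 < real N"
      using reals_Archimedean2 by blast
    have "dist (p m) (p n) < e" if "N \<le> m" "N \<le> n" for m n
    proof -
      have "0 < N" using N \<open>0 < e\<close> by (cases N) (auto simp: divide_less_0_iff)
      have "2 / real (Suc m) + 2 / real (Suc n) \<le> 2 / real N + 2 / real N"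
        using that \<open>0 < N\<close> by (intro add_mono divide_left_mono) auto
      also have "\<dots> < e\<^sup>2"
        using N \<open>0 < e\<close> \<open>0 < N\<close> by (simp add: field_simps)
      finally have "(norm (p m - p n))\<^sup>2 < e\<^sup>2"
        using pp[of m n] by linarith
      then show ?thesis
        using \<open>0 < e\<close> by (simp add: dist_norm power_less_imp_less_base)
    qed
    then show "\<exists>M. \<forall>m\<ge>M. \<forall>n\<ge>M. dist (p m) (p n) < e" by blast
  qed
  then obtain q where q: "p \<longlonglongrightarrow> q"
    using Cauchy_convergent convergent_def by blast
  then have qC: "q \<in> C"
    using closed_sequentially[OF assms(1)] pC by blast
  have lim1: "(\<lambda>n. (norm (x - p n))\<^sup>2) \<longlonglongrightarrow> (norm (x - q))\<^sup>2"
    by (intro tendsto_intros q)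
  have lim2: "(\<lambda>n. d\<^sup>2 + 1 / real (Suc n)) \<longlonglongrightarrow> d\<^sup>2 + 0"
    by (intro tendsto_add tendsto_const LIMSEQ_Suc lim_1_over_n)
  have "(norm (x - q))\<^sup>2 \<le> d\<^sup>2 + 0"
    by (rule LIMSEQ_le[OF lim1 lim2]) (intro exI allI impI less_imp_le p)
  then have "(norm (x - q))\<^sup>2 \<le> (norm (x - y))\<^sup>2" if "y \<in> C" for y
    using d_le[OF that] by linarith
  then have min: "norm (x - q) \<le> norm (x - y)" if "y \<in> C" for y
    using that power2_le_imp_le norm_ge_zero by metis
  have "ip (x - q) y = 0" if "y \<in> C" for y
  proof (rule ip_eq_0_if_closest)
    fix r
    have "q + r *\<^sub>R y \<in> C"
      using that qC assms(2) by (simp add: subspace_add subspace_scale)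
    from min[OF this] show "norm (x - q) \<le> norm (x - q - r *\<^sub>R y)"
      by (simp add: algebra_simps)
  qed
  with qC that show thesis by blast
qed

text \<open>The residual \<open>z - p\<close> of the projection onto the closure is orthogonal to \<open>S\<close>, hence to \<open>z\<close> by
  assumption; being orthogonal to \<open>p\<close> as well, it is orthogonal to itself.\<close>

lemma mem_closure_if_orthogonal:
  assumes "subspace S" and "\<And>y. (\<And>x. x \<in> S \<Longrightarrow> ip x y = 0) \<Longrightarrow> ip z y = 0"
  shows "z \<in> closure S"
proof -
  obtain p where p: "p \<in> closure S" "\<And>y. y \<in> closure S \<Longrightarrow> ip (z - p) y = 0"
    using projection[of "closure S" z] assms(1) by (metis closed_closure subspace_closure)
  have "ip z (z - p) = 0"
    using p(2) closure_subset[of S] by (intro assms(2)) (metis ip_sym subsetD)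
  moreover have "ip p (z - p) = 0"
    using p by (metis ip_sym)
  ultimately have "ip (z - p) (z - p) = 0" by (simp add: ip_diff)
  then show ?thesis using p(1) by (simp add: ip_norm)
qed

lemma dense_if_orthogonal_trivial:
  assumes "subspace S" and "\<And>y. (\<And>x. x \<in> S \<Longrightarrow> ip x y = 0) \<Longrightarrow> y = 0"
  shows "closure S = UNIV"
proof -
  have "z \<in> closure S" for z
    using assms zero_right by (intro mem_closure_if_orthogonal) force+
  then show ?thesis by blast
qed

section \<open>Perturbations with relative bound one\<close>

text \<open>If \<open>y\<close> is orthogonal to the range of \<open>M + t P\<close>, then
  \<open>ip (M x) y = - t * ip (P x) y \<le> t * norm (M x) * norm y\<close>; letting \<open>M x\<close> tend to
  \<open>y\<close> gives \<open>(norm y)\<^sup>2 \<le> t * (norm y)\<^sup>2\<close>.\<close>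

lemma dense_range_small_perturbation:
  fixes M P :: "'b::real_vector \<Rightarrow> 'a"
  assumes D: "subspace D"
    and M: "\<And>x y. x \<in> D \<Longrightarrow> y \<in> D \<Longrightarrow> M (x + y) = M x + M y"
      "\<And>r x. x \<in> D \<Longrightarrow> M (r *\<^sub>R x) = r *\<^sub>R M x"
    and P: "\<And>x y. x \<in> D \<Longrightarrow> y \<in> D \<Longrightarrow> P (x + y) = P x + P y"
      "\<And>r x. x \<in> D \<Longrightarrow> P (r *\<^sub>R x) = r *\<^sub>R P x"
    and dense: "closure (M ` D) = UNIV"
    and bound: "\<And>x. x \<in> D \<Longrightarrow> norm (P x) \<le> norm (M x)"
    and t: "0 \<le> t" "t < 1"
  shows "closure ((\<lambda>x. M x + t *\<^sub>R P x) ` D) = UNIV"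
proof (rule dense_if_orthogonal_trivial)
  show "subspace ((\<lambda>x. M x + t *\<^sub>R P x) ` D)"
    by (rule subspace_image_linear_on[OF D]) (simp_all add: M P algebra_simps)
next
  fix y
  assume orth: "\<And>x. x \<in> (\<lambda>x. M x + t *\<^sub>R P x) ` D \<Longrightarrow> ip x y = 0"
  obtain f where f: "\<And>n. f n \<in> D" and lim: "(\<lambda>n. M (f n)) \<longlonglongrightarrow> y"
  proof -
    have "y \<in> closure (M ` D)" using dense by simp
    then obtain g where "\<And>n. g n \<in> M ` D" "g \<longlonglongrightarrow> y"
      unfolding closure_sequential by blast
    then show thesis using that[of "\<lambda>n. inv_into D M (g n)"]
      by (simp add: inv_into_into f_inv_into_f)
  qed
  have "ip (M (f n)) y \<le> t * (norm (M (f n)) * norm y)" for n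
  proof -
    have "ip (M (f n)) y = - t * ip (P (f n)) y"
      using orth[of "M (f n) + t *\<^sub>R P (f n)"] f by (auto simp: ip_add ip_scaleR)
    also have "\<dots> \<le> t * \<bar>ip (P (f n)) y\<bar>"
      using t(1) by (simp add: abs_if mult_nonneg_nonpos)
    also have "\<bar>ip (P (f n)) y\<bar> \<le> norm (P (f n)) * norm y"
      by (rule Cauchy_Schwarz)
    also have "norm (P (f n)) * norm y \<le> norm (M (f n)) * norm y"
      using bound[OF f] by (simp add: mult_right_mono)
    finally show ?thesis using t(1) by (simp add: mult_left_mono)
  qed
  moreover have "(\<lambda>n. ip (M (f n)) y) \<longlonglongrightarrow> ip y y"
    by (intro tendsto lim tendsto_const)
  moreover have "(\<lambda>n. t * (norm (M (f n)) * norm y)) \<longlonglongrightarrow> t * (norm y * norm y)"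
    by (intro tendsto_intros lim)
  ultimately have "ip y y \<le> t * (norm y * norm y)"
    using LIMSEQ_le by blast
  then have "(1 - t) * (norm y)\<^sup>2 \<le> 0"
    by (simp add: ip_norm algebra_simps power2_eq_square)
  then show "y = 0"
    using t(2) by (simp add: mult_le_0_iff)
qed

text \<open>With \<open>s = 1 - t\<close> small, solve \<open>M x + t P x = y\<close> approximately. The vectors \<open>x\<close> and
  \<open>s P x\<close> then have norm at most about \<open>norm y\<close>, and \<open>(norm y)\<^sup>2\<close> differs little from
  \<open>- ip (s P x) y\<close>. Replacing \<open>y\<close> by a nearby \<open>z \<in> D\<close>, symmetry moves \<open>P\<close> onto the fixed
  vector \<open>z\<close>, and \<open>ip x (s P z)\<close> is small.\<close>

lemma orthogonal_range_trivial_at_bound_one: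
  fixes M P :: "'a \<Rightarrow> 'a"
  assumes D: "subspace D" "closure D = UNIV"
    and M: "\<And>x y. x \<in> D \<Longrightarrow> y \<in> D \<Longrightarrow> M (x + y) = M x + M y"
      "\<And>r x. x \<in> D \<Longrightarrow> M (r *\<^sub>R x) = r *\<^sub>R M x"
    and P: "\<And>x y. x \<in> D \<Longrightarrow> y \<in> D \<Longrightarrow> P (x + y) = P x + P y"
      "\<And>r x. x \<in> D \<Longrightarrow> P (r *\<^sub>R x) = r *\<^sub>R P x"
    and dense: "closure (M ` D) = UNIV"
    and bound: "\<And>x. x \<in> D \<Longrightarrow> norm (P x) \<le> norm (M x)"
    and below: "\<And>t x. 0 \<le> t \<Longrightarrow> t < 1 \<Longrightarrow> x \<in> D \<Longrightarrow> norm x \<le> norm (M x + t *\<^sub>R P x)"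
    and sym: "\<And>x y. x \<in> D \<Longrightarrow> y \<in> D \<Longrightarrow> ip (P x) y = ip x (P y)"
    and orth: "\<And>x. x \<in> D \<Longrightarrow> ip (M x + P x) y = 0"
  shows "y = 0"
proof (rule ccontr)
  assume "y \<noteq> 0"
  define b where "b = norm y"
  have b: "0 < b" using \<open>y \<noteq> 0\<close> by (simp add: b_def)
  obtain z where z: "z \<in> D" "norm (z - y) < b / 8"
    using closure_approachable[of y D] D(2) b by (metis UNIV_I dist_norm divide_pos_pos zero_less_numeral)
  \<comment> \<open>The parameter \<open>s\<close> is chosen after \<open>z\<close>, small enough for \<open>s P z\<close> to have norm at most \<open>b / 8\<close>.\<close>
  define c where "c = norm (P z) + 1"
  have c: "0 < c" by (simp add: c_def add_nonneg_pos)
  define s where "s = min 1 (b / (8 * c))"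
  have s: "0 < s" "s \<le> 1" using b c by (auto simp: s_def)
  have "s * norm (P z) \<le> s * c"
    using s by (simp add: c_def)
  also have "\<dots> \<le> b / (8 * c) * c"
    by (intro mult_right_mono) (use c in \<open>auto simp: s_def\<close>)
  also have "\<dots> = b / 8"
    using c by simp
  finally have sP: "s * norm (P z) \<le> b / 8" .
  have "closure ((\<lambda>x. M x + (1 - s) *\<^sub>R P x) ` D) = UNIV"
    by (rule dense_range_small_perturbation[OF D(1) M P dense bound]) (use s in auto)
  then obtain x where x: "x \<in> D" and xy: "norm (M x + (1 - s) *\<^sub>R P x - y) < b / 8"
    using closure_approachable[of y "(\<lambda>x. M x + (1 - s) *\<^sub>R P x) ` D"] b
    by (auto simp: dist_norm dest!: spec[of _ "b/8"])
  define v where "v = M x + (1 - s) *\<^sub>R P x"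
  have v: "norm v \<le> 9 / 8 * b"
    using norm_triangle_ineq2[of v y] xy by (simp add: v_def b_def)
  have nx: "norm x \<le> 9 / 8 * b"
    using below[of "1 - s" x] s x v by (simp add: v_def)
  have sPx: "norm (s *\<^sub>R P x) \<le> 9 / 8 * b"
  proof -
    have "M x = v - (1 - s) *\<^sub>R P x" by (simp add: v_def)
    then have "norm (M x) \<le> norm v + (1 - s) * norm (P x)"
      using norm_triangle_ineq4[of v "(1 - s) *\<^sub>R P x"] s by simp
    then have "s * norm (P x) \<le> norm v"
      using bound[OF x] by (simp add: algebra_simps)
    then show ?thesis using s v by simp
  qed
  \<comment> \<open>Since \<open>v + s P x = M x + P x\<close>, orthogonality expresses \<open>ip y y\<close> by terms that are all small.\<close>
  have "0 = ip v y + ip (s *\<^sub>R P x) y"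
    using orth[OF x] by (simp add: v_def ip_add ip_scaleR left_diff_distrib)
  also have "ip v y = ip y y + ip (v - y) y"
    by (simp add: ip_diff)
  also have "ip (s *\<^sub>R P x) y = ip (s *\<^sub>R P x) z - ip (s *\<^sub>R P x) (z - y)"
    by (simp add: ip_diff_right)
  also have "ip (s *\<^sub>R P x) z = ip x (s *\<^sub>R P z)"
    using sym[OF x z(1)] by (simp add: ip_scaleR ip_scaleR_right)
  finally have "b\<^sup>2 = - ip (v - y) y - ip x (s *\<^sub>R P z) + ip (s *\<^sub>R P x) (z - y)"
    by (simp add: ip_norm b_def)
  moreover have "\<bar>ip (v - y) y\<bar> \<le> b / 8 * b"
    by (rule order_trans[OF Cauchy_Schwarz mult_mono]) (use xy b in \<open>auto simp: v_def b_def\<close>)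
  moreover have "\<bar>ip x (s *\<^sub>R P z)\<bar> \<le> 9 / 8 * b * (b / 8)"
    by (rule order_trans[OF Cauchy_Schwarz mult_mono]) (use nx sP s b in auto)
  moreover have "\<bar>ip (s *\<^sub>R P x) (z - y)\<bar> \<le> 9 / 8 * b * (b / 8)"
    by (rule order_trans[OF Cauchy_Schwarz mult_mono]) (use sPx z b in auto)
  \<comment> \<open>The three errors add up to \<open>1/8 + 9/64 + 9/64 = 13/32\<close> of \<open>b\<^sup>2\<close>.\<close>
  ultimately have "b\<^sup>2 \<le> 13 / 32 * b\<^sup>2"
    by (simp add: power2_eq_square abs_le_iff)
  then show False using b by (simp add: power2_eq_square)
qed

end

text \<open>The analytic core, for operators given by functions on subspaces. The assumptions \<open>adj\<close> and
  \<open>adj_max\<close> together say that \<open>A\<close> is the adjoint of \<open>B\<close>; the conclusion is that the adjoint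
  of \<open>B + S\<close> is contained in \<open>A + R\<close>.\<close>

lemma perturbed_adjoint_maximal:
  fixes ipH :: "'h::banach \<Rightarrow> 'h \<Rightarrow> real" and ipK :: "'k::banach \<Rightarrow> 'k \<Rightarrow> real"
    and A R :: "'h \<Rightarrow> 'k" and B S :: "'k \<Rightarrow> 'h"
  assumes "real_hilbert_space ipH" "real_hilbert_space ipK"
    and DA: "subspace DA" "closure DA = UNIV" and DB: "subspace DB" "closure DB = UNIV"
    and A: "\<And>x y. x \<in> DA \<Longrightarrow> y \<in> DA \<Longrightarrow> A (x + y) = A x + A y"
      "\<And>r x. x \<in> DA \<Longrightarrow> A (r *\<^sub>R x) = r *\<^sub>R A x"
    and R: "\<And>x y. x \<in> DA \<Longrightarrow> y \<in> DA \<Longrightarrow> R (x + y) = R x + R y"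
      "\<And>r x. x \<in> DA \<Longrightarrow> R (r *\<^sub>R x) = r *\<^sub>R R x"
    and B: "\<And>x y. x \<in> DB \<Longrightarrow> y \<in> DB \<Longrightarrow> B (x + y) = B x + B y"
      "\<And>r x. x \<in> DB \<Longrightarrow> B (r *\<^sub>R x) = r *\<^sub>R B x"
    and S: "\<And>x y. x \<in> DB \<Longrightarrow> y \<in> DB \<Longrightarrow> S (x + y) = S x + S y"
      "\<And>r x. x \<in> DB \<Longrightarrow> S (r *\<^sub>R x) = r *\<^sub>R S x"
    and adj: "\<And>h k. h \<in> DA \<Longrightarrow> k \<in> DB \<Longrightarrow> ipH (B k) h = ipK k (A h)"
    and adj_max: "\<And>h w. (\<And>k. k \<in> DB \<Longrightarrow> ipH (B k) h = ipK k w) \<Longrightarrow> h \<in> DA \<and> A h = w"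
    and dual: "\<And>h k. h \<in> DA \<Longrightarrow> k \<in> DB \<Longrightarrow> ipH (S k) h = ipK k (R h)"
    and bound_R: "\<And>h. h \<in> DA \<Longrightarrow> (norm (R h))\<^sup>2 \<le> (norm (A h))\<^sup>2 + (norm h)\<^sup>2"
    and bound_S: "\<And>k. k \<in> DB \<Longrightarrow> (norm (S k))\<^sup>2 \<le> (norm (B k))\<^sup>2 + (norm k)\<^sup>2"
    and closed: "closed ((\<lambda>h. (h, A h + R h)) ` DA)"
    and hw: "\<And>k. k \<in> DB \<Longrightarrow> ipH (B k + S k) h = ipK k w"
  shows "h \<in> DA \<and> A h + R h = w"
proof -
  interpret H: real_hilbert_space ipH by fact
  interpret K: real_hilbert_space ipK by fact
  interpret HK: real_hilbert_space "\<lambda>x y. ipH (fst x) (fst y) + ipK (snd x) (snd y)"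
    using real_inner_product_prod[OF H.real_inner_product_axioms K.real_inner_product_axioms]
    by (rule real_hilbert_space.intro)
  have A0: "A 0 = 0" using A(2)[of 0 0] subspace_0[OF DA(1)] by simp
  have B0: "B 0 = 0" using B(2)[of 0 0] subspace_0[OF DB(1)] by simp
  define M where "M = (\<lambda>p. (B (snd p) + fst p, A (fst p) - snd p))"
  define P where "P = (\<lambda>p. (S (snd p), R (fst p)))"
  let ?D = "DA \<times> DB"
  have D: "subspace ?D" "closure ?D = UNIV"
    using DA DB by (simp_all add: subspace_Times closure_Times)
  have M: "M (p + q) = M p + M q" "M (r *\<^sub>R p) = r *\<^sub>R M p" if "p \<in> ?D" "q \<in> ?D" for p q r
    using that by (auto simp: M_def A B algebra_simps)
  have P: "P (p + q) = P p + P q" "P (r *\<^sub>R p) = r *\<^sub>R P p" if "p \<in> ?D" "q \<in> ?D" for p q r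
    using that by (auto simp: P_def R S)
  \<comment> \<open>The cross terms \<open>ipH (B k + t S k) x\<close> and \<open>- ipK (A x + t R x) k\<close> cancel. The case \<open>t = 0\<close>
    turns the two bounds into \<open>bound\<close>, and general \<open>t\<close> gives \<open>below\<close>.\<close>
  have norm_MP: "(norm (M (x, k) + t *\<^sub>R P (x, k)))\<^sup>2 =
      (norm (B k + t *\<^sub>R S k))\<^sup>2 + (norm (A x + t *\<^sub>R R x))\<^sup>2 + (norm x)\<^sup>2 + (norm k)\<^sup>2"
    if "x \<in> DA" "k \<in> DB" for x k t
  proof -
    have "M (x, k) + t *\<^sub>R P (x, k) = ((B k + t *\<^sub>R S k) + x, (A x + t *\<^sub>R R x) - k)"
      by (simp add: M_def P_def)
    moreover have "ipH (B k + t *\<^sub>R S k) x = ipK (A x + t *\<^sub>R R x) k"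
      using adj[OF that] dual[OF that] K.ip_sym[of "A x" k] K.ip_sym[of "R x" k]
      by (simp add: H.ip_add H.ip_scaleR K.ip_add K.ip_scaleR)
    moreover have "(norm (u + x, v - k))\<^sup>2 = (norm u)\<^sup>2 + (norm v)\<^sup>2 + (norm x)\<^sup>2 + (norm k)\<^sup>2"
      if "ipH u x = ipK v k" for u v
    proof -
      have "(norm (u + x, v - k))\<^sup>2 = (norm (u + x))\<^sup>2 + (norm (v - k))\<^sup>2"
        by (simp add: norm_Pair)
      then show ?thesis
        using that by (simp only: H.norm_add_sq K.norm_diff_sq)
    qed
    ultimately show ?thesis by simp
  qed
  have dense: "closure (M ` ?D) = UNIV"
  proof (rule HK.dense_if_orthogonal_trivial)
    show "subspace (M ` ?D)"
      by (rule subspace_image_linear_on[OF D(1)]) (use M in blast)+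
    fix y
    assume y: "\<And>p. p \<in> M ` ?D \<Longrightarrow> ipH (fst p) (fst y) + ipK (snd p) (snd y) = 0"
    have "ipH (B k) (fst y) = ipK k (snd y)" if "k \<in> DB" for k
      using y[OF imageI, of "(0, k)"] that subspace_0[OF DA(1)]
      by (simp add: M_def A0 K.minus_left)
    then have u: "fst y \<in> DA" "A (fst y) = snd y"
      using adj_max by blast+
    then have "ipH (fst y) (fst y) + ipK (snd y) (snd y) = 0"
      using y[OF imageI, of "(fst y, 0)"] subspace_0[OF DB(1)] by (simp add: M_def B0)
    then show "y = 0"
      by (simp add: H.ip_norm K.ip_norm prod_eq_iff add_nonneg_eq_0_iff)
  qed
  have bound: "norm (P p) \<le> norm (M p)" if "p \<in> ?D" for p
  proof -
    obtain x k where p: "p = (x, k)" "x \<in> DA" "k \<in> DB" using \<open>p \<in> ?D\<close> by blast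
    then have "(norm (P p))\<^sup>2 \<le> (norm (M p))\<^sup>2"
      using norm_MP[of x k 0] bound_R[of x] bound_S[of k] by (simp add: P_def norm_Pair flip: zero_prod_def)
    then show ?thesis by (rule power2_le_imp_le) simp
  qed
  have below: "norm p \<le> norm (M p + t *\<^sub>R P p)" if "p \<in> ?D" for p t
  proof -
    obtain x k where p: "p = (x, k)" "x \<in> DA" "k \<in> DB" using \<open>p \<in> ?D\<close> by blast
    then have "(norm p)\<^sup>2 \<le> (norm (M p + t *\<^sub>R P p))\<^sup>2"
      using norm_MP[of x k t] by (simp add: norm_Pair)
    then show ?thesis by (rule power2_le_imp_le) simp
  qed
  \<comment> \<open>The residual of the projection of \<open>(h, w)\<close> onto the graph of \<open>A + R\<close> is orthogonal to that
    graph and still lies in the graph of the adjoint of \<open>B + S\<close>; the two properties together are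
    orthogonality to the range of \<open>M + P\<close>.\<close>
  let ?G = "(\<lambda>h. (h, A h + R h)) ` DA"
  have "subspace ?G"
    by (rule subspace_image_linear_on[OF DA(1)]) (simp_all add: A R algebra_simps)
  then obtain p where "p \<in> ?G" and p: "\<And>q. q \<in> ?G \<Longrightarrow>
      ipH (fst ((h, w) - p)) (fst q) + ipK (snd ((h, w) - p)) (snd q) = 0"
    using HK.projection[OF closed, of "(h, w)"] by blast
  then obtain g where g: "g \<in> DA" "p = (g, A g + R g)" by blast
  have proj: "ipH (h - g) x + ipK (w - (A g + R g)) (A x + R x) = 0" if "x \<in> DA" for x
    using p[OF imageI[OF that]] by (simp add: g(2))
  have "(h - g, w - (A g + R g)) = 0"
  proof (rule HK.orthogonal_range_trivial_at_bound_one[OF D _ _ _ _ dense bound below])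
    fix p assume "p \<in> ?D"
    then obtain x k where p: "p = (x, k)" "x \<in> DA" "k \<in> DB" by blast
    have "ipH (B k + S k) (h - g) = ipK k (w - (A g + R g))"
      using hw[OF p(3)] adj[OF g(1) p(3)] dual[OF g(1) p(3)]
      by (simp add: H.ip_diff_right H.ip_add K.ip_diff_right K.ip_add_right)
    moreover have "ipH x (h - g) + ipK (A x + R x) (w - (A g + R g)) = 0"
      using proj[OF p(2)] by (metis H.ip_sym K.ip_sym)
    ultimately show "ipH (fst (M p + P p)) (fst (h - g, w - (A g + R g))) +
        ipK (snd (M p + P p)) (snd (h - g, w - (A g + R g))) = 0"
      by (simp add: M_def P_def p(1) H.ip_add K.ip_add K.ip_diff)
  next
    fix p q assume "p \<in> ?D" "q \<in> ?D"
    then show "ipH (fst (P p)) (fst q) + ipK (snd (P p)) (snd q) =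
        ipH (fst p) (fst (P q)) + ipK (snd p) (snd (P q))"
      using dual[of "fst q" "snd p"] dual[of "fst p" "snd q"]
      by (auto simp: P_def H.ip_sym K.ip_sym)
  qed (use M P in blast)+
  then show ?thesis
    using g by (simp add: zero_prod_def)
qed

section \<open>Unbounded operators and their adjoints\<close>

definition re_ip :: "('a \<Rightarrow> 'a \<Rightarrow> 's::real_or_complex) \<Rightarrow> 'a \<Rightarrow> 'a \<Rightarrow> real"
  where "re_ip ip x y = Re (to_complex (ip x y))"

lemma real_hilbert_space_re_ip:
  assumes "hilbert_space sc ip"
  shows "real_hilbert_space (re_ip ip)"
proof -
  interpret hilbert_space sc ip by fact
  show ?thesis
  proof
    show "re_ip ip (r *\<^sub>R x) y = r * re_ip ip x y" for r x y
      using ip_scale_left[of "of_real r" x y]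
      by (simp add: re_ip_def scale_of_real to_complex_mult to_complex_of_real)
    show "re_ip ip x y = re_ip ip y x" for x y
      by (simp add: re_ip_def ip_commute[of x y])
    show "re_ip ip x x = (norm x)\<^sup>2" for x
      unfolding re_ip_def ip_self to_complex_of_real by simp
  qed (simp add: re_ip_def ip_add_left to_complex_add)
qed

lemma (in hilbert_space) norm_scale: "norm (scale c x) = norm c * norm x"
proof -
  have "(norm (scale c x))\<^sup>2 = norm (ip (scale c x) (scale c x))"
    unfolding ip_self norm_of_real by simp
  also have "\<dots> = norm c * norm (ip x (scale c x))"
    by (simp add: ip_scale_left norm_mult)
  also have "norm (ip x (scale c x)) = norm (ip (scale c x) x)"
    by (metis complex_mod_cnj ip_commute norm_to_complex)
  also have "\<dots> = norm c * (norm x)\<^sup>2"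
    by (simp add: ip_scale_left norm_mult ip_self norm_power)
  finally have "(norm (scale c x))\<^sup>2 = (norm c * norm x)\<^sup>2"
    by (simp add: power_mult_distrib power2_eq_square)
  then show ?thesis
    by (simp add: power2_eq_iff_nonneg)
qed

lemma (in hilbert_space) continuous_scale: "continuous_on A (scale c)"
proof -
  have "bounded_linear (scale c)"
  proof
    show "scale c (r *\<^sub>R x) = r *\<^sub>R scale c x" for r x
      by (simp add: mult.commute flip: scale_of_real)
    show "\<exists>K. \<forall>x. norm (scale c x) \<le> norm x * K"
      by (intro exI[of _ "norm c"]) (simp add: norm_scale)
  qed (rule scale_right_distrib)
  then show ?thesis by (rule linear_continuous_on)
qed

lemma dom_op_plus: "dom (op_plus T U) = dom T \<inter> dom U"
  by (auto simp: op_plus_def split: if_splits)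

lemma hilbert_space_subspace_iff:
  assumes "hilbert_space sc ip"
  shows "module.subspace sc D \<longleftrightarrow>
    0 \<in> D \<and> (\<forall>x\<in>D. \<forall>y\<in>D. x + y \<in> D) \<and> (\<forall>c. \<forall>x\<in>D. sc c x \<in> D)"
  using module.subspace_def[of sc D] hilbert_space.axioms(1)[OF assms]
  by (simp add: module_iff_vector_space)

locale two_hilbert_spaces = A: hilbert_space scaleA ipA + B: hilbert_space scaleB ipB
  for scaleA :: "'s::real_or_complex \<Rightarrow> 'a::banach \<Rightarrow> 'a" and ipA
    and scaleB :: "'s \<Rightarrow> 'b::banach \<Rightarrow> 'b" and ipB
begin

sublocale reA: real_hilbert_space "re_ip ipA"
  by (rule real_hilbert_space_re_ip) (rule A.hilbert_space_axioms)

sublocale reB: real_hilbert_space "re_ip ipB"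
  by (rule real_hilbert_space_re_ip) (rule B.hilbert_space_axioms)

sublocale re: real_hilbert_space
  "\<lambda>x y. re_ip ipA (fst x) (fst y) + re_ip ipB (snd x) (snd y)"
  using real_inner_product_prod[OF reA.real_inner_product_axioms reB.real_inner_product_axioms]
  by (rule real_hilbert_space.intro)

abbreviation linear_op where "linear_op \<equiv> linear_operator scaleA scaleB"

lemma linear_op_iff:
  "linear_op T \<longleftrightarrow>
    0 \<in> dom T \<and> (\<forall>x\<in>dom T. \<forall>y\<in>dom T. x + y \<in> dom T \<and> the (T (x + y)) = the (T x) + the (T y)) \<and>
    (\<forall>c. \<forall>x\<in>dom T. scaleA c x \<in> dom T \<and> the (T (scaleA c x)) = scaleB c (the (T x)))"
  unfolding linear_operator_def hilbert_space_subspace_iff[OF A.hilbert_space_axioms] by blast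

lemma linear_op_real:
  assumes "linear_op T"
  shows "subspace (dom T)"
    and "x \<in> dom T \<Longrightarrow> y \<in> dom T \<Longrightarrow> the (T (x + y)) = the (T x) + the (T y)"
    and "x \<in> dom T \<Longrightarrow> the (T (r *\<^sub>R x)) = r *\<^sub>R the (T x)"
proof -
  note T = assms[unfolded linear_op_iff]
  have scaleR: "r *\<^sub>R x \<in> dom T \<and> the (T (r *\<^sub>R x)) = r *\<^sub>R the (T x)" if "x \<in> dom T" for r x
    unfolding A.scale_of_real[symmetric] B.scale_of_real[symmetric] using T that by blast
  show "subspace (dom T)"
    by (rule subspaceI) (use T scaleR in blast)+
  show "x \<in> dom T \<Longrightarrow> y \<in> dom T \<Longrightarrow> the (T (x + y)) = the (T x) + the (T y)"
    using T by blast
  show "x \<in> dom T \<Longrightarrow> the (T (r *\<^sub>R x)) = r *\<^sub>R the (T x)"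
    using scaleR by blast
qed

lemma linear_op_0:
  assumes "linear_op T"
  shows "T 0 = Some 0"
proof -
  have "0 \<in> dom T" using assms unfolding linear_op_iff by blast
  then show ?thesis using linear_op_real(3)[OF assms, of 0 0] by auto
qed

lemma subspace_graph:
  assumes "linear_op T"
  shows "subspace (Map.graph T)"
  unfolding graph_eq_to_snd_dom
  by (rule subspace_image_linear_on) (simp_all add: linear_op_real[OF assms])

lemma linear_op_plus:
  assumes "linear_op T" "linear_op U"
  shows "linear_op (op_plus T U)"
proof -
  have the: "the (op_plus T U x) = the (T x) + the (U x)" if "x \<in> dom T" "x \<in> dom U" for x
    using that by (simp add: op_plus_def)
  note [simp] = the B.scale_right_distrib dom_op_plus
    assms[unfolded linear_op_iff, THEN conjunct1]
    assms[unfolded linear_op_iff, THEN conjunct2, THEN conjunct1, rule_format]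
    assms[unfolded linear_op_iff, THEN conjunct2, THEN conjunct2, rule_format]
  show ?thesis
    unfolding linear_op_iff by (simp del: domIff)
qed

text \<open>A nonzero difference \<open>d\<close> of the two scalar products at \<open>x\<close> becomes \<open>1\<close>, whose real part does
  not vanish, when \<open>x\<close> is replaced by \<open>x\<close> scaled by \<open>inverse d\<close>. So passing to real parts loses
  nothing, whichever the scalar field is.\<close>

lemma ip_adjoint_iff_re_ip:
  assumes "linear_op T"
  shows "(\<forall>x\<in>dom T. ipB (the (T x)) y = ipA x z) \<longleftrightarrow>
    (\<forall>x\<in>dom T. re_ip ipB (the (T x)) y = re_ip ipA x z)"
proof (intro iffI ballI)
  fix x assume *: "\<forall>x\<in>dom T. re_ip ipB (the (T x)) y = re_ip ipA x z" and x: "x \<in> dom T"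
  define d where "d = ipB (the (T x)) y - ipA x z"
  have "scaleA (inverse d) x \<in> dom T"
    "the (T (scaleA (inverse d) x)) = scaleB (inverse d) (the (T x))"
    using assms x unfolding linear_op_iff by auto
  with * have "Re (to_complex (inverse d * ipB (the (T x)) y)) = Re (to_complex (inverse d * ipA x z))"
    by (metis A.ip_scale_left B.ip_scale_left re_ip_def)
  moreover have "inverse d * ipB (the (T x)) y = inverse d * d + inverse d * ipA x z"
    by (simp add: d_def algebra_simps)
  ultimately have "Re (to_complex (inverse d * d)) = 0"
    by (simp add: to_complex_add)
  moreover have "to_complex (1::'s) = 1"
    using to_complex_of_real[of 1, where ?'a = 's] by simp
  ultimately have "d = 0" by (cases "d = 0") auto
  then show "ipB (the (T x)) y = ipA x z" by (simp add: d_def)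
qed (simp add: re_ip_def)

lemma op_adjoint_eq_Some_iff:
  assumes "linear_op T" "densely_defined T"
  shows "op_adjoint ipA ipB T y = Some z \<longleftrightarrow>
    (\<forall>x\<in>dom T. re_ip ipB (the (T x)) y = re_ip ipA x z)"
proof -
  have uniq: "z1 = z2"
    if "\<forall>x\<in>dom T. ipB (the (T x)) y = ipA x z1" "\<forall>x\<in>dom T. ipB (the (T x)) y = ipA x z2"
    for z1 z2
  proof -
    have "re_ip ipA x z1 = re_ip ipA x z2" if "x \<in> dom T" for x
      using that \<open>\<forall>x\<in>dom T. _ = ipA x z1\<close> \<open>\<forall>x\<in>dom T. _ = ipA x z2\<close> by (simp add: re_ip_def)
    then have "re_ip ipA x (z1 - z2) = 0" if "x \<in> dom T" for x
      using that by (simp add: reA.ip_diff_right)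
    then have "z1 - z2 = 0"
      using assms(2) unfolding densely_defined_def by (rule reA.eq_0_if_orthogonal_dense[rotated])
    then show ?thesis by simp
  qed
  have the: "(THE z. \<forall>x\<in>dom T. ipB (the (T x)) y = ipA x z) = z"
    if "\<forall>x\<in>dom T. ipB (the (T x)) y = ipA x z" for z
    using that uniq by (intro the_equality) blast+
  have "op_adjoint ipA ipB T y = Some z \<longleftrightarrow> (\<forall>x\<in>dom T. ipB (the (T x)) y = ipA x z)"
  proof (cases "\<exists>z'. \<forall>x\<in>dom T. ipB (the (T x)) y = ipA x z'")
    case True
    then obtain z' where z': "\<forall>x\<in>dom T. ipB (the (T x)) y = ipA x z'" by blast
    have "op_adjoint ipA ipB T y = Some z'"
      unfolding op_adjoint_def if_P[OF True] the[OF z'] ..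
    moreover have "(\<forall>x\<in>dom T. ipB (the (T x)) y = ipA x z) \<longleftrightarrow> z' = z"
      using z' uniq[OF z'] by (intro iffI) simp_all
    ultimately show ?thesis by simp
  next
    case False
    then have "op_adjoint ipA ipB T y = None"
      unfolding op_adjoint_def by (rule if_not_P)
    moreover have "\<not> (\<forall>x\<in>dom T. ipB (the (T x)) y = ipA x z)"
      using False by (rule contrapos_nn) (rule exI)
    ultimately show ?thesis by simp
  qed
  then show ?thesis
    unfolding ip_adjoint_iff_re_ip[OF assms(1)] .
qed

lemma op_adjoint_eq_Some_lin:
  assumes T: "linear_op T" "densely_defined T"
  shows "op_adjoint ipA ipB T 0 = Some 0"
    and "\<lbrakk>op_adjoint ipA ipB T y1 = Some z1; op_adjoint ipA ipB T y2 = Some z2\<rbrakk>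
      \<Longrightarrow> op_adjoint ipA ipB T (y1 + y2) = Some (z1 + z2)"
    and "op_adjoint ipA ipB T y1 = Some z1 \<Longrightarrow> op_adjoint ipA ipB T (r *\<^sub>R y1) = Some (r *\<^sub>R z1)"
  unfolding op_adjoint_eq_Some_iff[OF T]
  by (simp_all add: reA.zero_right reB.zero_right reA.ip_add_right reB.ip_add_right
      reA.ip_scaleR_right reB.ip_scaleR_right)

lemma op_adjoint_real_linear:
  assumes T: "linear_op T" "densely_defined T"
  defines "T' \<equiv> op_adjoint ipA ipB T"
  shows "subspace (dom T')"
    and "x \<in> dom T' \<Longrightarrow> y \<in> dom T' \<Longrightarrow> the (T' (x + y)) = the (T' x) + the (T' y)"
    and "x \<in> dom T' \<Longrightarrow> the (T' (r *\<^sub>R x)) = r *\<^sub>R the (T' x)"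
proof -
  note lin = op_adjoint_eq_Some_lin[OF T, folded T'_def]
  show "subspace (dom T')"
    by (rule subspaceI) (use lin in blast)+
  show "x \<in> dom T' \<Longrightarrow> y \<in> dom T' \<Longrightarrow> the (T' (x + y)) = the (T' x) + the (T' y)"
    using lin(2) by fastforce
  show "x \<in> dom T' \<Longrightarrow> the (T' (r *\<^sub>R x)) = r *\<^sub>R the (T' x)"
    using lin(3) by fastforce
qed

text \<open>If \<open>h\<close> is orthogonal to the domain of the adjoint, then \<open>(0, h)\<close> lies in the closure of
  the graph of \<open>T\<close>: a pair \<open>q\<close> orthogonal to that graph has \<open>snd q\<close> in the domain of the adjoint, hence
  is orthogonal to \<open>(0, h)\<close>. As that closure is again a graph, \<open>h = 0\<close>.\<close>

lemma op_adjoint_dense: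
  assumes T: "linear_op T" "densely_defined T" and "closable_operator scaleA scaleB T"
  shows "closure (dom (op_adjoint ipA ipB T)) = UNIV"
proof (rule reB.dense_if_orthogonal_trivial)
  show "subspace (dom (op_adjoint ipA ipB T))"
    using op_adjoint_real_linear(1)[OF T] .
  fix h
  assume orth: "\<And>y. y \<in> dom (op_adjoint ipA ipB T) \<Longrightarrow> re_ip ipB y h = 0"
  have "(0, h) \<in> closure (Map.graph T)"
  proof (rule re.mem_closure_if_orthogonal[OF subspace_graph[OF T(1)]])
    fix q :: "'a \<times> 'b"
    assume q: "\<And>x. x \<in> Map.graph T \<Longrightarrow>
      re_ip ipA (fst x) (fst q) + re_ip ipB (snd x) (snd q) = 0"
    have "re_ip ipB (the (T x)) (snd q) = re_ip ipA x (- fst q)" if "x \<in> dom T" for x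
      using q[of "(x, the (T x))"] that by (auto simp: reA.minus_right Map.graph_def)
    then have "op_adjoint ipA ipB T (snd q) = Some (- fst q)"
      using op_adjoint_eq_Some_iff[OF T] by blast
    then show "re_ip ipA (fst (0, h)) (fst q) + re_ip ipB (snd (0, h)) (snd q) = 0"
      using orth[of "snd q"] by (auto simp: reA.zero_left reB.ip_sym)
  qed
  then obtain T' where "linear_op T'" "T' 0 = Some h"
    using assms(3) unfolding closable_operator_def by (metis in_graphD)
  then show "h = 0"
    using linear_op_0[of T'] by simp
qed

lemma closable_if_graph_closure_single_valued:
  assumes T: "linear_op T" and single: "\<And>v. (0, v) \<in> closure (Map.graph T) \<Longrightarrow> v = 0"
  shows "closable_operator scaleA scaleB T"
proof -
  define C where "C = closure (Map.graph T)"
  have add: "(x + x', y + y') \<in> C" if "(x, y) \<in> C" "(x', y') \<in> C" for x y x' y'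
    using subspace_add[OF subspace_closure[OF subspace_graph[OF T]], of "(x, y)" "(x', y')"] that
    by (simp add: C_def)
  have zero: "(0, 0) \<in> C"
    using subspace_0[OF subspace_closure[OF subspace_graph[OF T]]] by (simp add: C_def zero_prod_def)
  have scale: "(scaleA c x, scaleB c y) \<in> C" if "(x, y) \<in> C" for c x y
  proof -
    have "(\<lambda>p. (scaleA c (fst p), scaleB c (snd p))) (x, y) \<in> closure (Map.graph T)"
    proof (rule closure_map_closed[where f = "\<lambda>p. (scaleA c (fst p), scaleB c (snd p))"])
      show "continuous_on UNIV (\<lambda>p. (scaleA c (fst p), scaleB c (snd p)))"
        using continuous_on_compose2[OF A.continuous_scale[of UNIV] continuous_on_fst[OF continuous_on_id]]
          continuous_on_compose2[OF B.continuous_scale[of UNIV] continuous_on_snd[OF continuous_on_id]]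
        by (intro continuous_on_Pair) auto
      show "(scaleA c (fst p), scaleB c (snd p)) \<in> Map.graph T" if "p \<in> Map.graph T" for p
      proof -
        obtain x where x: "x \<in> dom T" "p = (x, the (T x))"
          using \<open>p \<in> Map.graph T\<close> unfolding graph_eq_to_snd_dom by blast
        then have "scaleA c x \<in> dom T" and eq: "the (T (scaleA c x)) = scaleB c (the (T x))"
          using T unfolding linear_op_iff by blast+
        then have "(scaleA c x, the (T (scaleA c x))) \<in> Map.graph T"
          unfolding graph_eq_to_snd_dom by blast
        then show ?thesis by (simp add: x(2) eq)
      qed
    qed (use that C_def in simp)
    then show ?thesis by (simp add: C_def)
  qed
  have uniq: "y = y'" if "(x, y) \<in> C" "(x, y') \<in> C" for x y y'
    using add[OF that(1) scale[OF that(2), of "-1"]] single[of "y - y'"]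
    by (simp add: C_def)
  define T' where "T' = (\<lambda>x. if \<exists>y. (x, y) \<in> C then Some (SOME y. (x, y) \<in> C) else None)"
  have T': "T' x = Some y \<longleftrightarrow> (x, y) \<in> C" for x y
  proof (cases "\<exists>y. (x, y) \<in> C")
    case True
    then have "T' x = Some (SOME y. (x, y) \<in> C)"
      unfolding T'_def by (rule if_P)
    then show ?thesis using someI_ex[OF True] uniq by auto
  qed (simp add: T'_def)
  have mem: "x \<in> dom T' \<and> the (T' x) = y" if "(x, y) \<in> C" for x y
    using that T'[of x y] by auto
  have "Map.graph T' = C"
    by (auto simp: Map.graph_def T')
  moreover have "linear_op T'"
    unfolding linear_op_iff
  proof (intro conjI ballI allI)
    show "0 \<in> dom T'" using mem zero by blast
    fix x assume "x \<in> dom T'"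
    then have x: "(x, the (T' x)) \<in> C" using T'[of x "the (T' x)"] by auto
    show "scaleA c x \<in> dom T'" "the (T' (scaleA c x)) = scaleB c (the (T' x))" for c
      using mem[OF scale[OF x]] by blast+
    fix y assume "y \<in> dom T'"
    then have y: "(y, the (T' y)) \<in> C" using T'[of y "the (T' y)"] by auto
    show "x + y \<in> dom T'" "the (T' (x + y)) = the (T' x) + the (T' y)"
      using mem[OF add[OF x y]] by blast+
  qed
  ultimately show ?thesis
    unfolding closable_operator_def C_def by blast
qed

text \<open>For \<open>y\<close> in the domain of the adjoint, with value \<open>z\<close>, the pair \<open>(- z, y)\<close> is orthogonal to
  the graph of \<open>T\<close> and so to its closure. Hence \<open>(0, v)\<close> in the closure forces \<open>v\<close> to be
  orthogonal to a dense set.\<close>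

lemma closable_if_op_adjoint_dense:
  assumes T: "linear_op T" "densely_defined T"
    and dense: "closure (dom (op_adjoint ipA ipB T)) = UNIV"
  shows "closable_operator scaleA scaleB T"
proof (rule closable_if_graph_closure_single_valued[OF T(1)])
  fix v assume v: "(0, v) \<in> closure (Map.graph T)"
  have "re_ip ipB y v = 0" if "y \<in> dom (op_adjoint ipA ipB T)" for y
  proof -
    obtain z where "op_adjoint ipA ipB T y = Some z" using \<open>y \<in> _\<close> by blast
    then have z: "\<forall>x\<in>dom T. re_ip ipB (the (T x)) y = re_ip ipA x z"
      using op_adjoint_eq_Some_iff[OF T] by blast
    have "re_ip ipA (fst p) (fst (- z, y)) + re_ip ipB (snd p) (snd (- z, y)) = 0"
      if "p \<in> Map.graph T" for p
    proof -
      obtain x where "x \<in> dom T" "p = (x, the (T x))"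
        using \<open>p \<in> Map.graph T\<close> unfolding graph_eq_to_snd_dom by blast
      then show ?thesis using z by (simp add: reA.minus_right)
    qed
    from re.orthogonal_closure[OF this v]
    have "re_ip ipA 0 (- z) + re_ip ipB v y = 0" by simp
    then show ?thesis by (simp add: reA.zero_left reB.ip_sym)
  qed
  then show "v = 0"
    using reB.eq_0_if_orthogonal_dense[OF dense] by blast
qed

end

section \<open>The adjoint of the perturbed operator\<close>

theorem theorem3p3:
  fixes scaleH :: "'s::real_or_complex \<Rightarrow> 'h::banach \<Rightarrow> 'h" and ipH :: "'h \<Rightarrow> 'h \<Rightarrow> 's"
    and scaleK :: "'s \<Rightarrow> 'k::banach \<Rightarrow> 'k" and ipK :: "'k \<Rightarrow> 'k \<Rightarrow> 's"
    and R :: "'h \<rightharpoonup> 'k" and B S :: "'k \<rightharpoonup> 'h"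
  assumes "hilbert_space scaleH ipH" and "hilbert_space scaleK ipK"
    and "linear_operator scaleH scaleK R"
    and "linear_operator scaleK scaleH B"
    and "linear_operator scaleK scaleH S"
    and a: "dom (op_adjoint ipK ipH B) \<subseteq> dom R" "dom B \<subseteq> dom S"
    and b: "densely_defined B" "closable_operator scaleK scaleH B"
    and c: "closed_operator (op_plus (op_adjoint ipK ipH B) R)"
    and d: "\<And>h k. h \<in> dom (op_adjoint ipK ipH B) \<Longrightarrow> k \<in> dom B \<Longrightarrow>
      ipK (the (R h)) k = ipH h (the (S k))"
    and e: "\<And>h. h \<in> dom (op_adjoint ipK ipH B) \<Longrightarrow>
      (norm (the (R h)))\<^sup>2 \<le> (norm (the (op_adjoint ipK ipH B h)))\<^sup>2 + (norm h)\<^sup>2"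
    and f: "\<And>k. k \<in> dom B \<Longrightarrow>
      (norm (the (S k)))\<^sup>2 \<le> (norm (the (B k)))\<^sup>2 + (norm k)\<^sup>2"
  shows "densely_defined (op_plus B S) \<and> closable_operator scaleK scaleH (op_plus B S) \<and>
    op_adjoint ipK ipH (op_plus B S) = op_plus (op_adjoint ipK ipH B) R"
proof -
  interpret KH: two_hilbert_spaces scaleK ipK scaleH ipH
    using assms(1,2) by (simp add: two_hilbert_spaces_def)
  interpret HK: two_hilbert_spaces scaleH ipH scaleK ipK
    using assms(1,2) by (simp add: two_hilbert_spaces_def)
  let ?A = "op_adjoint ipK ipH B"
  note B = \<open>linear_operator scaleK scaleH B\<close> and S = \<open>linear_operator scaleK scaleH S\<close>
    and R = \<open>linear_operator scaleH scaleK R\<close>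
  note Blin = KH.linear_op_real[OF B] and Slin = KH.linear_op_real[OF S]
    and Rlin = HK.linear_op_real[OF R] and Alin = KH.op_adjoint_real_linear[OF B b(1)]
  note adj = KH.op_adjoint_eq_Some_iff[OF B b(1)]
  have dom_BS: "dom (op_plus B S) = dom B"
    using a(2) dom_op_plus[of B S] by blast
  have BS: "the (op_plus B S k) = the (B k) + the (S k)" if "k \<in> dom B" for k
    using that a(2) by (auto simp: op_plus_def)
  have dom_AR: "dom (op_plus ?A R) = dom ?A"
    using a(1) dom_op_plus[of ?A R] by blast
  have AR: "op_plus ?A R h = Some w \<longleftrightarrow> h \<in> dom ?A \<and> the (?A h) + the (R h) = w" for h w
    using a(1) by (auto simp: op_plus_def)
  have dense: "densely_defined (op_plus B S)"
    using b(1) by (simp add: densely_defined_def dom_BS)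
  note lin = KH.linear_op_plus[OF B S]
  have A_dense: "closure (dom ?A) = UNIV"
    using KH.op_adjoint_dense[OF B b] .
  have dual: "re_ip ipH (the (S k)) h = re_ip ipK k (the (R h))" if "h \<in> dom ?A" "k \<in> dom B" for h k
    using d[OF that] by (metis re_ip_def KH.reA.ip_sym KH.reB.ip_sym)
  have A_adj: "re_ip ipH (the (B k)) h = re_ip ipK k (the (?A h))" if "h \<in> dom ?A" "k \<in> dom B" for h k
    using that adj[of h "the (?A h)"] by auto
  have graph: "Map.graph (op_plus ?A R) = (\<lambda>h. (h, the (?A h) + the (R h))) ` dom ?A"
    unfolding graph_eq_to_snd_dom dom_AR using a(1) by (intro image_cong) (auto simp: op_plus_def)
  have closed: "closed ((\<lambda>h. (h, the (?A h) + the (R h))) ` dom ?A)"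
    using c by (simp add: closed_operator_def graph)
  have B_dense: "closure (dom B) = UNIV"
    using b(1) by (simp add: densely_defined_def)
  have A_max: "h \<in> dom ?A \<and> the (?A h) = w"
    if "\<And>k. k \<in> dom B \<Longrightarrow> re_ip ipH (the (B k)) h = re_ip ipK k w" for h w
    using that adj[of h w] by auto
  have R_lin: "the (R (x + y)) = the (R x) + the (R y)"
    if "x \<in> dom ?A" "y \<in> dom ?A" for x y
    using that a(1) Rlin(2) by blast
  have R_lin': "the (R (r *\<^sub>R x)) = r *\<^sub>R the (R x)" if "x \<in> dom ?A" for x r
    using that a(1) Rlin(3) by blast
  have S_lin: "the (S (x + y)) = the (S x) + the (S y)"
    if "x \<in> dom B" "y \<in> dom B" for x y
    using that a(2) Slin(2) by blast
  have S_lin': "the (S (r *\<^sub>R x)) = r *\<^sub>R the (S x)" if "x \<in> dom B" for x r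
    using that a(2) Slin(3) by blast
  have "op_adjoint ipK ipH (op_plus B S) h = Some w \<longleftrightarrow> op_plus ?A R h = Some w" for h w
  proof
    assume "op_adjoint ipK ipH (op_plus B S) h = Some w"
    then have hw: "re_ip ipH (the (B k) + the (S k)) h = re_ip ipK k w" if "k \<in> dom B" for k
      using that unfolding KH.op_adjoint_eq_Some_iff[OF lin dense] dom_BS by (simp add: BS)
    have "h \<in> dom ?A \<and> the (?A h) + the (R h) = w"
      by (rule perturbed_adjoint_maximal[where DB = "dom B"
          and A = "\<lambda>h. the (?A h)" and R = "\<lambda>h. the (R h)"
          and B = "\<lambda>k. the (B k)" and S = "\<lambda>k. the (S k)",
          OF KH.reB.real_hilbert_space_axioms KH.reA.real_hilbert_space_axioms
          Alin(1) A_dense Blin(1) B_dense Alin(2,3) R_lin R_lin' Blin(2,3) S_lin S_lin' A_adj A_max dual e f closed hw])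
    then show "op_plus ?A R h = Some w" by (simp add: AR)
  next
    assume "op_plus ?A R h = Some w"
    then have "h \<in> dom ?A" "w = the (?A h) + the (R h)" by (auto simp: AR)
    then show "op_adjoint ipK ipH (op_plus B S) h = Some w"
      unfolding KH.op_adjoint_eq_Some_iff[OF lin dense] dom_BS
      by (auto simp: BS A_adj dual KH.reA.ip_add_right KH.reB.ip_add)
  qed
  then have eq: "op_adjoint ipK ipH (op_plus B S) = op_plus ?A R"
    by (metis option.exhaust ext)
  have "closable_operator scaleK scaleH (op_plus B S)"
    using KH.closable_if_op_adjoint_dense[OF lin dense] A_dense by (simp add: eq dom_AR)
  then show ?thesis
    using dense eq by simp
qed

end
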